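(* Let $\nu>-\frac{1}{2}$. Then, for all $x>0$, $$\mathbf{L}_{\nu+1}(x)<\frac{x^{\nu+2}}{\sqrt{\pi}\,2^{\nu+1}(\nu+1)\Gamma(\nu+\frac{3}{2})}\;{}_2F_3\bigg(1,\nu+1;\frac{3}{2},\nu+\frac{3}{2},\nu+2;\frac{x^2}{4}\bigg)$$ and $$\frac{x^{\nu+2}}{\sqrt{\pi}\,2^{\nu+1}(\nu+1)\Gamma(\nu+\frac{3}{2})}\;{}_2F_3\bigg(1,\nu+1;\frac{3}{2},\nu+\frac{3}{2},\nu+2;\frac{x^2}{4}\bigg)<\mathbf{L}_{\nu+1}(x)\bigg\{1+\frac{1}{2\nu+1}\bigg(1-\frac{\mathbf{L}_{\nu+3}(x)}{\mathbf{L}_{\nu+1}(x)}\bigg)\bigg\}-\frac{x^{\nu+2}}{\sqrt{\pi}\,2^{\nu+2}(2\nu+1)(\nu+1)\Gamma(\nu+\frac{5}{2})}.$$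
   Context: For real $\nu$ and $x>0$, $\mathbf{L}_\nu$ denotes the modified Struve function of the first kind, $$\mathbf{L}_\nu(x)=\sum_{k=0}^\infty \frac{\big(\frac{1}{2}x\big)^{\nu+2k+1}}{\Gamma(k+\frac{3}{2})\,\Gamma(k+\nu+\frac{3}{2})}.$$ The generalized hypergeometric function is $${}_pF_q\big(a_1,\ldots,a_p;b_1,\ldots,b_q;x\big)=\sum_{k=0}^\infty \frac{(a_1)_k\cdots(a_p)_k}{(b_1)_k\cdots(b_q)_k}\frac{x^k}{k!},$$ where the Pochhammer symbol is $(a)_0=1$ and $(a)_k=a(a+1)(a+2)\cdots(a+k-1)$ for $k\geq1$. *)

theory Defs
  imports "HOL-Analysis.Analysis"
begin

text \<open>
  The library's \<open>Gamma\<close> is \<open>0\<close> at its poles, so \<open>1 / Gamma\<close> is \<open>0\<close> there: a term with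
  \<open>k + \<nu> + 3/2\<close> a nonpositive integer vanishes, as in the usual convention. The definition is
  meant for \<open>x > 0\<close>, where \<open>powr\<close> is the real power.
\<close>
definition struveL :: "real \<Rightarrow> real \<Rightarrow> real" where
  "struveL \<nu> x =
     (\<Sum>k. (x / 2) powr (\<nu> + 2 * real k + 1) /
           (Gamma (real k + 3 / 2) * Gamma (real k + \<nu> + 3 / 2)))"

text \<open>
  The library's formal series \<open>fps_hypergeo as bs c\<close> has the argument scaled by \<open>c\<close>;
  \<open>c = 1\<close> is the standard series, evaluated here at \<open>x\<close>.
\<close>
definition hypergeom :: "real list \<Rightarrow> real list \<Rightarrow> real \<Rightarrow> real" where
  "hypergeom as bs x = eval_fps (fps_hypergeo as bs 1) x"

lemma hypergeom_2F3:
  "hypergeom [a1, a2] [b1, b2, b3] x =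
     (\<Sum>k. pochhammer a1 k * pochhammer a2 k /
           (pochhammer b1 k * pochhammer b2 k * pochhammer b3 k) * (x ^ k / fact k))"
  by (simp add: hypergeom_def eval_fps_def)

end

theory Submission
  imports Defs
begin

text \<open>
  The middle expression is \<open>\<integral>\<^sub>0\<^sup>x L\<^sub>\<nu>(t) dt\<close>, and every quantity is a power series in
  \<open>x/2\<close> (times \<open>(x/2) powr (\<nu> + 2)\<close>) whose \<open>k\<close>-th coefficient is
  \<open>1 / (\<Gamma>(k + 3/2) \<Gamma>(k + \<nu> + 3/2))\<close> times a rational function of \<open>k\<close> and \<open>\<nu>\<close>.
  Both inequalities hold coefficientwise; in the second one there is equality for \<open>k = 0\<close>, where
  the subtracted elementary term enters, and strict inequality for \<open>k \<ge> 1\<close>.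
\<close>

definition struve_term :: "real \<Rightarrow> real \<Rightarrow> nat \<Rightarrow> real" where
  "struve_term \<nu> x k = (x / 2) powr (\<nu> + 2 * real k + 1) /
     (Gamma (real k + 3 / 2) * Gamma (real k + \<nu> + 3 / 2))"

lemma Gamma_add_one_pos:
  fixes z :: real
  assumes "z > 0"
  shows "Gamma (z + 1) = z * Gamma z"
  using assms by (intro Gamma_plus1) (auto elim!: nonpos_Ints_cases)

lemma Gamma_three_halves: "Gamma (3 / 2 :: real) = sqrt pi / 2"
  using Gamma_add_one_pos [of "1 / 2"] Gamma_one_half_real by simp

lemma struve_term_pos:
  assumes "\<nu> > - 3 / 2" "x > 0"
  shows "struve_term \<nu> x k > 0"
  unfolding struve_term_def using assms
  by (intro divide_pos_pos mult_pos_pos Gamma_real_pos) auto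

lemma struve_term_Suc:
  assumes "\<nu> > - 3 / 2" "x > 0"
  shows "struve_term \<nu> x (Suc k) =
    struve_term \<nu> x k * ((x / 2)\<^sup>2 / ((real k + 3 / 2) * (real k + \<nu> + 3 / 2)))"
proof -
  have p: "(x / 2) powr (\<nu> + 2 * real (Suc k) + 1) = (x / 2) powr (\<nu> + 2 * real k + 1) * (x / 2)\<^sup>2"
    using assms by (simp add: powr_add [symmetric] flip: powr_numeral)
  have "Gamma (real (Suc k) + 3 / 2) = (real k + 3 / 2) * Gamma (real k + 3 / 2)"
    using Gamma_add_one_pos [of "real k + 3 / 2"] by (simp add: algebra_simps)
  moreover have "Gamma (real (Suc k) + \<nu> + 3 / 2) = (real k + \<nu> + 3 / 2) * Gamma (real k + \<nu> + 3 / 2)"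
    using Gamma_add_one_pos [of "real k + \<nu> + 3 / 2"] assms by (simp add: algebra_simps)
  ultimately show ?thesis
    unfolding struve_term_def p by simp
qed

text \<open>Raising the order by one leaves the index alone: one more power of \<open>x / 2\<close>
  appears and only the second Gamma factor moves, by its functional equation. Series of neighbouring
  orders thus become comparable term by term.\<close>

lemma struve_term_order_Suc:
  assumes "\<nu> > - 3 / 2" "x > 0"
  shows "struve_term (\<nu> + 1) x k = struve_term \<nu> x k * (x / 2) / (real k + \<nu> + 3 / 2)"
proof -
  have p: "(x / 2) powr (\<nu> + 1 + 2 * real k + 1) = (x / 2) powr (\<nu> + 2 * real k + 1) * (x / 2)"
    using powr_add [of "x / 2" "\<nu> + 2 * real k + 1" 1] assms by (simp add: algebra_simps)
  have "Gamma (real k + (\<nu> + 1) + 3 / 2) = (real k + \<nu> + 3 / 2) * Gamma (real k + \<nu> + 3 / 2)"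
    using Gamma_add_one_pos [of "real k + \<nu> + 3 / 2"] assms by (simp add: algebra_simps)
  then show ?thesis
    unfolding struve_term_def p by simp
qed

lemma summable_struve_term:
  assumes "\<nu> > - 3 / 2" "x > 0"
  shows "summable (struve_term \<nu> x)"
proof (rule summable_ratio_test)
  \<comment> \<open>For \<open>n \<ge> N\<close> the factor \<open>n + 3/2\<close> exceeds
    \<open>2 * (x/2)\<^sup>2\<close>. The extra \<open>+ 1\<close> gives \<open>n \<ge> 1\<close>,
    so that \<open>n + \<nu> + 3/2 \<ge> 1\<close> even for negative \<open>\<nu>\<close>; the ratio
    of consecutive terms is then at most 1/2.\<close>
  define N where "N = nat \<lceil>2 * (x / 2)\<^sup>2\<rceil> + 1"
  show "(1 / 2 :: real) < 1" by simp
  fix n :: nat assume n: "N \<le> n"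
  have "2 * (x / 2)\<^sup>2 \<le> real n" "1 \<le> real n"
    using n unfolding N_def by linarith+
  then have "(2 * (x / 2)\<^sup>2) * 1 \<le> (real n + 3 / 2) * (real n + \<nu> + 3 / 2)"
    using assms by (intro mult_mono) auto
  then have "(x / 2)\<^sup>2 / ((real n + 3 / 2) * (real n + \<nu> + 3 / 2)) \<le> 1 / 2"
    using assms by (simp add: divide_le_eq)
  then have "struve_term \<nu> x (Suc n) \<le> struve_term \<nu> x n * (1 / 2)"
    unfolding struve_term_Suc [OF assms]
    using struve_term_pos [OF assms, of n] by (intro mult_left_mono) auto
  then show "norm (struve_term \<nu> x (Suc n)) \<le> 1 / 2 * norm (struve_term \<nu> x n)"
    using struve_term_pos [OF assms, of n] struve_term_pos [OF assms, of "Suc n"] by simp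
qed

lemma struveL_sums:
  assumes "\<nu> > - 3 / 2" "x > 0"
  shows "struve_term \<nu> x sums struveL \<nu> x"
  using summable_sums [OF summable_struve_term [OF assms]]
  by (simp add: struveL_def struve_term_def [abs_def])

lemma struveL_pos:
  assumes "\<nu> > - 3 / 2" "x > 0"
  shows "struveL \<nu> x > 0"
  using suminf_pos [OF summable_struve_term [OF assms]] struve_term_pos [OF assms]
    sums_unique [OF struveL_sums [OF assms]] by simp

text \<open>Term \<open>k\<close> of order \<open>\<nu> + 2\<close> carries the same power of
  \<open>x / 2\<close> as term \<open>k + 1\<close> of order \<open>\<nu>\<close>, so the higher
  series is written in the terms of the lower one with the index shifted. Index 0 has no
  counterpart; its summand is added on both sides.\<close>

lemma struveL_add_two_sums:
  assumes "\<nu> > - 3 / 2" "x > 0"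
  shows "(\<lambda>k. struve_term \<nu> x k * (real k + 1 / 2) / (real k + \<nu> + 3 / 2)) sums
    (struveL (\<nu> + 2) x + struve_term \<nu> x 0 * (1 / 2) / (\<nu> + 3 / 2))"
proof -
  have eq: "struve_term (\<nu> + 2) x k =
      struve_term \<nu> x (Suc k) * (real (Suc k) + 1 / 2) / (real (Suc k) + \<nu> + 3 / 2)" for k
  proof -
    have "struve_term (\<nu> + 2) x k
        = struve_term \<nu> x k * (x / 2) / (real k + \<nu> + 3 / 2) * (x / 2) / (real k + \<nu> + 5 / 2)"
      using struve_term_order_Suc [of "\<nu> + 1" x k] struve_term_order_Suc [of \<nu> x k] assms
      by (simp add: algebra_simps)
    also have "\<dots> = struve_term \<nu> x k * ((x / 2)\<^sup>2 / ((real k + 3 / 2) * (real k + \<nu> + 3 / 2)))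
        * (real k + 3 / 2) / (real k + \<nu> + 5 / 2)"
    proof -
      have cancel: "s * h / p * h / q = s * (h\<^sup>2 / (c * p)) * c / q"
        if "c \<noteq> 0" for s p h q c :: real
        using that by (simp add: power2_eq_square)
      show ?thesis
        by (rule cancel) linarith
    qed
    also have "\<dots> = struve_term \<nu> x (Suc k) * (real (Suc k) + 1 / 2) / (real (Suc k) + \<nu> + 3 / 2)"
      unfolding struve_term_Suc [OF assms] by (simp add: add_ac)
    finally show ?thesis .
  qed
  have "(\<lambda>k. struve_term \<nu> x (Suc k) * (real (Suc k) + 1 / 2) / (real (Suc k) + \<nu> + 3 / 2))
      sums struveL (\<nu> + 2) x"
    using struveL_sums [of "\<nu> + 2" x] assms by (simp only: flip: eq)
  from sums_Suc [OF this] show ?thesis by simp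
qed

text \<open>Splitting off the first or the last factor of \<open>pochhammer a (Suc k)\<close> gives
  two products that are equal.\<close>

lemma pochhammer_ratio_Suc:
  fixes a :: real
  assumes "a > 0"
  shows "pochhammer a k / pochhammer (a + 1) k = a / (a + real k)"
  using assms pochhammer_rec [of a k] pochhammer_rec' [of a k] pochhammer_pos [of "a + 1" k]
  by (simp add: frac_eq_eq mult.commute)

text \<open>The \<open>k\<close>-th summand is \<open>x powr (-\<nu>)\<close> times the integral of
  \<open>t powr \<nu> * struve_term \<nu> t k\<close> over \<open>t\<close> from 0 to
  \<open>x\<close>, convergent at 0 since \<open>\<nu> > -1\<close>. The proof itself only matches
  coefficients with the hypergeometric series.\<close>

lemma hypergeom_struve_sums:
  assumes "\<nu> > - 1" "x > 0"
  shows "(\<lambda>k. struve_term \<nu> x k * (x / 2) / (real k + \<nu> + 1)) sums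
    (x powr (\<nu> + 2) / (sqrt pi * 2 powr (\<nu> + 1) * (\<nu> + 1) * Gamma (\<nu> + 3 / 2))
      * hypergeom [1, \<nu> + 1] [3 / 2, \<nu> + 3 / 2, \<nu> + 2] (x\<^sup>2 / 4))" (is "?f sums (?c * ?H)")
proof -
  have \<nu>: "\<nu> > - 3 / 2" using assms by simp
  have cpos: "?c > 0"
    using assms by (auto intro!: divide_pos_pos mult_pos_pos Gamma_real_pos)
  have c: "?c * (\<nu> + 1) * (Gamma (3 / 2) * Gamma (\<nu> + 3 / 2)) = (x / 2) powr (\<nu> + 2)"
  proof -
    have "(2 :: real) powr (\<nu> + 2) = 2 * 2 powr (\<nu> + 1)"
      using powr_add [of 2 "\<nu> + 1" 1] by (simp add: add_ac)
    moreover have "Gamma (\<nu> + 3 / 2) \<noteq> 0"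
      using Gamma_real_pos [of "\<nu> + 3 / 2"] \<nu> by linarith
    ultimately show ?thesis
      unfolding Gamma_three_halves using assms by (simp add: powr_divide)
  qed
  have f: "?f k = ?c * (pochhammer 1 k * pochhammer (\<nu> + 1) k /
      (pochhammer (3 / 2) k * pochhammer (\<nu> + 3 / 2) k * pochhammer (\<nu> + 2) k)
      * ((x\<^sup>2 / 4) ^ k / fact k))" (is "_ = ?c * ?h k") for k
  proof -
    have G: "pochhammer z k * Gamma z = Gamma (real k + z)" "Gamma z > 0" if "z > 0" for z :: real
    proof -
      show "Gamma z > 0" using that by (rule Gamma_real_pos)
      moreover have "z \<notin> \<int>\<^sub>\<le>\<^sub>0" using that by (auto elim!: nonpos_Ints_cases)
      ultimately show "pochhammer z k * Gamma z = Gamma (real k + z)"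
        using pochhammer_Gamma [of z k] by (simp add: add.commute)
    qed
    have P: "(x / 2) powr (\<nu> + 2 * real k + 1) * (x / 2) = (x / 2) powr (\<nu> + 2) * (x\<^sup>2 / 4) ^ k"
    proof -
      have "(x\<^sup>2 / 4) ^ k = (x / 2) powr (2 * real k)"
        using assms powr_realpow [of "x / 2" "2 * k"] by (simp add: power_mult power_divide)
      then show ?thesis
        using assms powr_add [of "x / 2" "\<nu> + 2 * real k + 1" 1]
        by (simp add: powr_add [symmetric] add_ac)
    qed
    have R: "pochhammer (\<nu> + 1) k / pochhammer (\<nu> + 2) k = (\<nu> + 1) / (real k + \<nu> + 1)"
      using pochhammer_ratio_Suc [of "\<nu> + 1" k] assms by (simp add: add_ac)
    have "?h k = pochhammer (\<nu> + 1) k / pochhammer (\<nu> + 2) k *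
        (x\<^sup>2 / 4) ^ k / (pochhammer (3 / 2) k * pochhammer (\<nu> + 3 / 2) k)"
      by (simp add: pochhammer_fact [symmetric])
    also have "?c * \<dots> = ?c * (\<nu> + 1) * (x\<^sup>2 / 4) ^ k /
        ((real k + \<nu> + 1) * (pochhammer (3 / 2) k * pochhammer (\<nu> + 3 / 2) k))"
      unfolding R by simp
    \<comment> \<open>Both sides of the fraction are expanded by the two Gamma values: below, they
      turn the Pochhammer symbols into shifted Gammas; above, they reduce the prefactor to a pure
      power by \<open>c\<close>.\<close>
    also have "\<dots> = ?c * (\<nu> + 1) * (Gamma (3 / 2) * Gamma (\<nu> + 3 / 2)) * (x\<^sup>2 / 4) ^ k /
        ((real k + \<nu> + 1) * ((pochhammer (3 / 2) k * Gamma (3 / 2)) *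
          (pochhammer (\<nu> + 3 / 2) k * Gamma (\<nu> + 3 / 2))))"
    proof -
      have cancel: "a * b / (p * (q * r)) = a * (g * h) * b / (p * ((q * g) * (r * h)))"
        if "g > 0" "h > 0" for a b p q r g h :: real
        using that by simp
      show ?thesis
        by (rule cancel) (use G(2) \<nu> in auto)
    qed
    also have "\<dots> = ?f k"
      unfolding c using \<nu> by (simp add: G(1) struve_term_def P [symmetric] add_ac)
    finally show ?thesis by simp
  qed
  have "summable ?f"
  proof (rule summable_comparison_test')
    show "summable (\<lambda>k. struve_term \<nu> x k * (x / 2 / (\<nu> + 1)))"
      by (intro summable_mult2 summable_struve_term \<nu> assms)
    fix n :: nat assume "0 \<le> n"
    have "x / 2 / (real n + \<nu> + 1) \<le> x / 2 / (\<nu> + 1)"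
      using assms by (intro divide_left_mono) auto
    then have "struve_term \<nu> x n * (x / 2 / (real n + \<nu> + 1)) \<le> struve_term \<nu> x n * (x / 2 / (\<nu> + 1))"
      using struve_term_pos [OF \<nu> assms(2), of n] by (intro mult_left_mono) auto
    then show "norm (?f n) \<le> struve_term \<nu> x n * (x / 2 / (\<nu> + 1))"
      using assms struve_term_pos [OF \<nu> assms(2), of n] by (simp add: abs_mult)
  qed
  then have "summable (\<lambda>k. ?c * ?h k)"
    unfolding f .
  \<comment> \<open>\<open>hypergeom\<close> unfolds to a bare infinite sum, so convergence has to
    be known before it can be used; it is inherited from \<open>?f\<close> because \<open>?c\<close>
    is nonzero.\<close>
  then have "summable ?h"
    using cpos by (simp only: summable_cmult_iff) auto
  then have "(\<lambda>k. ?c * ?h k) sums (?c * ?H)"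
    unfolding hypergeom_2F3 by (intro sums_mult summable_sums)
  then show ?thesis
    unfolding f .
qed

theorem corollary2p2:
  fixes \<nu> x :: real
  assumes "\<nu> > - 1 / 2" and "x > 0"
  shows "struveL (\<nu> + 1) x
           < x powr (\<nu> + 2) / (sqrt pi * 2 powr (\<nu> + 1) * (\<nu> + 1) * Gamma (\<nu> + 3 / 2))
             * hypergeom [1, \<nu> + 1] [3 / 2, \<nu> + 3 / 2, \<nu> + 2] (x\<^sup>2 / 4)
         \<and> x powr (\<nu> + 2) / (sqrt pi * 2 powr (\<nu> + 1) * (\<nu> + 1) * Gamma (\<nu> + 3 / 2))
             * hypergeom [1, \<nu> + 1] [3 / 2, \<nu> + 3 / 2, \<nu> + 2] (x\<^sup>2 / 4)
           < struveL (\<nu> + 1) x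
               * (1 + 1 / (2 * \<nu> + 1) * (1 - struveL (\<nu> + 3) x / struveL (\<nu> + 1) x))
             - x powr (\<nu> + 2)
               / (sqrt pi * 2 powr (\<nu> + 2) * (2 * \<nu> + 1) * (\<nu> + 1) * Gamma (\<nu> + 5 / 2))"
    (is "?L < ?M \<and> ?M < _ - ?T")
proof
  have \<nu>: "\<nu> > - 3 / 2" "\<nu> > - 1" "\<nu> + 1 > - 3 / 2" "\<nu> + 3 / 2 > 0" "2 * \<nu> + 1 > 0"
    using assms by simp_all
  \<comment> \<open>\<open>A\<close> and \<open>C\<close> are the series of the left and middle
    expressions; \<open>B\<close> is that of order \<open>\<nu> + 3\<close> in shifted form, with
    the extra term \<open>B 0\<close>. \<open>D\<close> comes from multiplying the second inequality
    by \<open>2 * \<nu> + 1\<close>, which clears its inner fractions.\<close>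
  define A where "A k = struve_term (\<nu> + 1) x k" for k
  define C where "C k = struve_term \<nu> x k * (x / 2) / (real k + \<nu> + 1)" for k
  define B where "B k = A k * (real k + 1 / 2) / (real k + \<nu> + 5 / 2)" for k
  define D where "D k = (2 * \<nu> + 2) * A k - B k - (2 * \<nu> + 1) * C k" for k
  have A_pos: "A k > 0" for k
    unfolding A_def using struve_term_pos \<nu>(3) assms(2) .
  have C_eq: "C k = A k * (real k + \<nu> + 3 / 2) / (real k + \<nu> + 1)" for k
    proof -
    have "real k + \<nu> + 3 / 2 \<noteq> 0" using \<nu>(4) by linarith
    moreover have "s / r = s / p * p / r" if "p \<noteq> 0" for s p r :: real
      using that by simp
    ultimately show ?thesis
      unfolding A_def C_def struve_term_order_Suc [OF \<nu>(1) assms(2)] by blast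
  qed
  have A_sums: "A sums ?L"
    unfolding A_def using struveL_sums [OF \<nu>(3) assms(2)] by simp
  have C_sums: "C sums ?M"
    unfolding C_def by (rule hypergeom_struve_sums) (use assms in auto)
  have B_sums: "B sums (struveL (\<nu> + 3) x + B 0)"
    using struveL_add_two_sums [OF \<nu>(3) assms(2)] by (simp add: B_def [abs_def] A_def add_ac)
  have D_sums: "D sums ((2 * \<nu> + 2) * ?L - (struveL (\<nu> + 3) x + B 0) - (2 * \<nu> + 1) * ?M)"
    unfolding D_def by (intro sums_diff sums_mult A_sums B_sums C_sums)

  \<comment> \<open>The ratio \<open>C k / A k\<close> is
    \<open>1 + (1/2) / (k + \<nu> + 1)\<close>.\<close>
  have "A k < C k" for k
    unfolding C_eq using A_pos [of k] \<nu> by (simp add: field_simps)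
  then have "0 < suminf (\<lambda>k. C k - A k)"
    by (intro suminf_pos sums_summable [OF sums_diff [OF C_sums A_sums]]) simp
  then show "?L < ?M"
    using sums_unique [OF sums_diff [OF C_sums A_sums]] by simp

  \<comment> \<open>The \<open>A\<close> and \<open>C\<close> parts combine to
    \<open>A k * (k + 1/2) / (k + \<nu> + 1)\<close>. Subtracting \<open>B k\<close> leaves the
    difference of the reciprocals of \<open>k + \<nu> + 1\<close> and
    \<open>k + \<nu> + 5/2\<close>, whence the factor 3/2.\<close>
  have D_eq: "D k = A k * (3 / 2 * (real k + 1 / 2)) / ((real k + \<nu> + 5 / 2) * (real k + \<nu> + 1))" for k
    unfolding D_def B_def C_eq using \<nu> by (simp add: divide_simps) (simp add: algebra_simps)
  have "D k > 0" for k
    unfolding D_eq using A_pos [of k] \<nu> by (intro divide_pos_pos mult_pos_pos) auto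
  \<comment> \<open>Dropping all terms but the first loses a positive amount; this is where
    strictness comes from.\<close>
  then have "sum D {..<1} < suminf D"
    by (intro sum_less_suminf sums_summable [OF D_sums])
  then have "D 0 + B 0 < (2 * \<nu> + 2) * ?L - struveL (\<nu> + 3) x - (2 * \<nu> + 1) * ?M"
    using sums_unique [OF D_sums] by simp
  \<comment> \<open>Adding \<open>B 0\<close> cancels its occurrence in \<open>D 0\<close>. What
    remains, \<open>(2 * \<nu> + 2) * A 0 - (2 * \<nu> + 1) * C 0\<close>, is exactly the scaled
    elementary term.\<close>
  moreover have "D 0 + B 0 = (2 * \<nu> + 1) * ?T"
  proof -
    have A0: "A 0 = 2 * (x / 2) powr (\<nu> + 2) / (sqrt pi * Gamma (\<nu> + 5 / 2))"
      unfolding A_def struve_term_def by (simp add: Gamma_three_halves add_ac)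
    have "D 0 + B 0 = A 0 / (2 * (\<nu> + 1))"
      unfolding D_eq B_def using \<nu> by (simp add: divide_simps) (simp add: algebra_simps)
    also have "\<dots> = (x / 2) powr (\<nu> + 2) / (sqrt pi * Gamma (\<nu> + 5 / 2)) / (\<nu> + 1)"
    proof -
      have "2 * a / b / (2 * c) = a / b / c" for a b c :: real
        by simp
      then show ?thesis unfolding A0 .
    qed
    also have "\<dots> = (2 * \<nu> + 1) * ?T"
      using \<nu> assms by (simp add: powr_divide mult_ac)
    finally show ?thesis .
  qed
  ultimately have "(2 * \<nu> + 1) * ?M < (2 * \<nu> + 2) * ?L - struveL (\<nu> + 3) x - (2 * \<nu> + 1) * ?T"
    by linarith
  also have "\<dots> = (2 * \<nu> + 1) *
      (?L * (1 + 1 / (2 * \<nu> + 1) * (1 - struveL (\<nu> + 3) x / ?L)) - ?T)"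
  proof -
    \<comment> \<open>Positivity of \<open>l\<close>, here the Struve value of order
      \<open>\<nu> + 1\<close>, justifies cancelling it against the quotient
      \<open>m / l\<close>.\<close>
    have alg: "(n + 1) * l - m - n * t = n * (l * (1 + 1 / n * (1 - m / l)) - t)"
      if "n > 0" "l > 0" for n l m t :: real
      using that by (simp add: field_simps)
    show ?thesis
      using alg [OF \<nu>(5) struveL_pos [OF \<nu>(3) assms(2)], of "struveL (\<nu> + 3) x" ?T]
      by (simp only: add.assoc one_add_one)
  qed
  finally show "?M < ?L * (1 + 1 / (2 * \<nu> + 1) * (1 - struveL (\<nu> + 3) x / ?L)) - ?T"
    using \<nu>(5) by (simp only: mult_less_cancel_left_pos)
qed

end
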